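(* Let $x$ satisfy the two-dimensional Volterra integral equation of the second kind $$x(s,t)=\mathcal{F}(s,t)+\int_{a(t)}^{s}K_1(s,t,\sigma)\,x(\sigma,t)\,d\sigma+\int_{b(s)}^{t}K_2(s,t,\tau)\,x(s,\tau)\,d\tau,\qquad (s,t)\in\Omega.$$ If the forcing term $\mathcal{F}$ is continuous on $\Omega$, and the kernels $K_1,K_2$ are continuous on the compact set $$\{(s,t,\sigma,\tau): (s,t)\in\Omega,\ a(t)\le\sigma\le s,\ b(s)\le\tau\le t\},$$ then there exists a unique continuous solution $x$ on $\Omega$.
   Context: A bounded rectangle $[0,S]\times[0,T]\subset\mathbb{R}^2$ and continuous functions $a:[0,T]\to[0,S]$ and $b:[0,S]\to[0,T]$ are fixed. For a constant $c>0$, $\Omega$ is the (truncated) finite-cylinder domain, taken as the compact set $\Omega=\{(s,t): 0\le s\le S,\ 0\le t\le T,\ s+t\ge c\}$. All functions are real-valued. In the application to the Cauchy--Goursat problem one takes $a(t)=\max(c-t,0)$ and $b(s)=\max(c-s,0)$.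
   Formalization: Added so that the equation is defined on Ω: for every (s,t) in Ω, a(t) ≤ s and b(s) ≤ t, and both segments of integration lie in Ω; where Ω has points this forces a(t)=max(c−t,0) and b(s)=max(c−s,0). *)

theory Defs
  imports "HOL-Analysis.Analysis"
begin

definition cyl_domain :: "real \<Rightarrow> real \<Rightarrow> real \<Rightarrow> (real \<times> real) set" where
  "cyl_domain S T c = {(s, t). 0 \<le> s \<and> s \<le> S \<and> 0 \<le> t \<and> t \<le> T \<and> s + t \<ge> c}"

definition kernel_domain ::
  "(real \<times> real) set \<Rightarrow> (real \<Rightarrow> real) \<Rightarrow> (real \<Rightarrow> real) \<Rightarrow> (real \<times> real \<times> real \<times> real) set" where
  "kernel_domain \<Omega> a b =
     {(s, t, \<sigma>, \<tau>). (s, t) \<in> \<Omega> \<and> a t \<le> \<sigma> \<and> \<sigma> \<le> s \<and> b s \<le> \<tau> \<and> \<tau> \<le> t}"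

text \<open>
  The equation on \<open>\<Omega>\<close> only makes sense for a function given on \<open>\<Omega>\<close>, and kernels given on
  \<open>kernel_domain\<close>, if for each point of \<open>\<Omega>\<close> the lower limits do not exceed the upper ones
  and both segments of integration stay inside \<open>\<Omega>\<close>.
\<close>

definition limits_compatible ::
  "(real \<times> real) set \<Rightarrow> (real \<Rightarrow> real) \<Rightarrow> (real \<Rightarrow> real) \<Rightarrow> bool" where
  "limits_compatible \<Omega> a b \<longleftrightarrow>
     (\<forall>(s, t) \<in> \<Omega>. a t \<le> s \<and> (\<forall>\<sigma> \<in> {a t..s}. (\<sigma>, t) \<in> \<Omega>)
                 \<and> b s \<le> t \<and> (\<forall>\<tau> \<in> {b s..t}. (s, \<tau>) \<in> \<Omega>))"

text \<open>
  The integral over a set is unoriented; under \<open>limits_compatible\<close> this agrees with the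
  oriented integral.  Likewise only the values of \<open>x\<close> on \<open>\<Omega>\<close> are then used.
\<close>

definition volterra_solution ::
  "(real \<times> real) set \<Rightarrow> (real \<Rightarrow> real) \<Rightarrow> (real \<Rightarrow> real) \<Rightarrow> (real \<times> real \<Rightarrow> real) \<Rightarrow>
   (real \<Rightarrow> real \<Rightarrow> real \<Rightarrow> real) \<Rightarrow> (real \<Rightarrow> real \<Rightarrow> real \<Rightarrow> real) \<Rightarrow> (real \<times> real \<Rightarrow> real) \<Rightarrow> bool" where
  "volterra_solution \<Omega> a b F K1 K2 x \<longleftrightarrow>
     (\<forall>(s, t) \<in> \<Omega>. x (s, t) = F (s, t)
        + integral {a t..s} (\<lambda>\<sigma>. K1 s t \<sigma> * x (\<sigma>, t))
        + integral {b s..t} (\<lambda>\<tau>. K2 s t \<tau> * x (s, \<tau>)))"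

text \<open>The limits occurring in the Cauchy-Goursat problem are compatible.\<close>

lemma limits_compatible_Goursat:
  "limits_compatible (cyl_domain S T c) (\<lambda>t. max (c - t) 0) (\<lambda>s. max (c - s) 0)"
  by (auto simp: limits_compatible_def cyl_domain_def)

end

theory Submission imports Defs begin

text \<open>
  The right-hand side of the equation defines an operator \<open>A\<close> on the continuous functions on
  \<open>\<Omega>\<close>, and the solutions are its fixed points.  In the supremum norm \<open>A\<close> need not be a
  contraction, because the kernels may be large.  The remedy is Bielecki's weight: distances are
  measured relative to \<open>exp (\<mu> * (s + t))\<close> with a large rate \<open>\<mu>\<close>.  A Volterra integral only
  looks back along a horizontal or vertical segment, on which \<open>s + t\<close> rises at unit speed to its
  value at the end point, so integrating the weight along it gains a factor \<open>1 / \<mu>\<close>.  If \<open>M1\<close>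
  and \<open>M2\<close> bound the kernels, \<open>A\<close> therefore contracts by \<open>(M1 + M2) / \<mu>\<close>, and the Banach
  fixed-point theorem gives existence and uniqueness at once on all of \<open>\<Omega>\<close>.

  The two integrals are instances of one construction, \<open>volterra_family\<close>: integration along a
  path on which a level function, here \<open>s + t\<close>, increases at unit speed up to its value at the
  given point.  The gain is \<open>volterra_op_weighted_bound\<close>.  That \<open>A\<close> preserves continuity
  although the limits of integration move, and that the kernels are bounded, both follow by
  rescaling every segment of integration to \<open>{0..1}\<close>, which turns the domain of a kernel into a
  product with a fixed compact interval.  The fixed-point theorem enters through
  \<open>weighted_contraction_fixed_point\<close>.
\<close>

section \<open>Integrals with continuously varying limits\<close>

lemma continuous_on_unit_interval_pullback:
  fixes f :: "'a::topological_space \<Rightarrow> real \<Rightarrow> 'b::topological_space"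
  assumes "continuous_on U lo" "continuous_on U hi"
    and le: "\<And>p. p \<in> U \<Longrightarrow> lo p \<le> hi p"
    and "continuous_on (SIGMA p:U. {lo p..hi p}) (\<lambda>(p, \<sigma>). f p \<sigma>)"
  shows "continuous_on (U \<times> {0..1}) (\<lambda>(p, r). f p (lo p + (hi p - lo p) * r))"
proof -
  have lim: "continuous_on (U \<times> {0..1::real}) (\<lambda>z. lo (fst z))"
    "continuous_on (U \<times> {0..1::real}) (\<lambda>z. hi (fst z))"
    by (rule continuous_on_compose2[OF assms(1)] continuous_on_compose2[OF assms(2)],
        auto intro!: continuous_intros)+
  have inside: "lo p + (hi p - lo p) * r \<le> hi p" if "p \<in> U" "0 \<le> r" "r \<le> 1" for p r
    using mult_left_mono[of r 1 "hi p - lo p"] le[OF that(1)] that by simp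
  have "continuous_on (U \<times> {0..1})
      (\<lambda>z. (\<lambda>(p, \<sigma>). f p \<sigma>) (fst z, lo (fst z) + (hi (fst z) - lo (fst z)) * snd z))"
    by (rule continuous_on_compose2[OF assms(4)])
      (auto intro!: continuous_intros lim inside simp: le)
  then show ?thesis by (simp add: case_prod_unfold)
qed

lemma integral_unit_interval_substitution:
  fixes f :: "real \<Rightarrow> real"
  assumes "l \<le> h" "continuous_on {l..h} f"
  shows "integral {l..h} f = (h - l) * integral {0..1} (\<lambda>r. f (l + (h - l) * r))"
proof -
  have "l + (h - l) * r \<le> h" if "0 \<le> r" "r \<le> 1" for r
    using mult_left_mono[of r 1 "h - l"] assms(1) that by simp
  then have "((\<lambda>r. (h - l) *\<^sub>R f (l + (h - l) * r)) has_integral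
      integral {l + (h - l) * 0..l + (h - l) * 1} f) {0..1}"
    using assms
    by (intro has_integral_substitution[where c = l and d = h])
      (auto intro!: derivative_eq_intros)
  then show ?thesis
    by (simp add: has_integral_iff integral_mult_right)
qed

lemma continuous_on_section:
  assumes "continuous_on (SIGMA p:U. I p) (\<lambda>(p, \<sigma>). f p \<sigma>)" "p \<in> U"
  shows "continuous_on (I p) (f p)"
proof -
  have "continuous_on (I p) (\<lambda>\<sigma>. (\<lambda>(p, \<sigma>). f p \<sigma>) (p, \<sigma>))"
    by (rule continuous_on_compose2[OF assms(1)]) (auto intro!: continuous_intros assms(2))
  then show ?thesis by simp
qed

text \<open>
  After rescaling to \<open>{0..1}\<close> the limits occur only as a continuous factor and inside the
  integrand, so this becomes continuity of an integral over a fixed interval in a parameter.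
\<close>

lemma continuous_on_integral_variable_limits:
  fixes f :: "'a::topological_space \<Rightarrow> real \<Rightarrow> real"
  assumes lo: "continuous_on U lo" and hi: "continuous_on U hi"
    and le: "\<And>p. p \<in> U \<Longrightarrow> lo p \<le> hi p"
    and f: "continuous_on (SIGMA p:U. {lo p..hi p}) (\<lambda>(p, \<sigma>). f p \<sigma>)"
  shows "continuous_on U (\<lambda>p. integral {lo p..hi p} (f p))"
proof -
  have "continuous_on U (\<lambda>p. integral (cbox 0 1) (\<lambda>r. f p (lo p + (hi p - lo p) * r)))"
    using continuous_on_unit_interval_pullback[OF assms]
    by (intro integral_continuous_on_param) simp
  then have "continuous_on U
      (\<lambda>p. (hi p - lo p) * integral {0..1} (\<lambda>r. f p (lo p + (hi p - lo p) * r)))"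
    by (auto intro!: continuous_intros lo hi)
  moreover have "integral {lo p..hi p} (f p)
      = (hi p - lo p) * integral {0..1} (\<lambda>r. f p (lo p + (hi p - lo p) * r))" if "p \<in> U" for p
    using that le continuous_on_section[OF f] by (intro integral_unit_interval_substitution) auto
  ultimately show ?thesis by (simp cong: continuous_on_cong)
qed

text \<open>
  The rescaling maps the compact set \<open>U \<times> {0..1}\<close> onto the set over which the bound is taken.
\<close>

lemma bounded_between_continuous_limits:
  fixes f :: "'a::topological_space \<Rightarrow> real \<Rightarrow> real"
  assumes "compact U"
    and lo: "continuous_on U lo" and hi: "continuous_on U hi"
    and le: "\<And>p. p \<in> U \<Longrightarrow> lo p \<le> hi p"
    and f: "continuous_on (SIGMA p:U. {lo p..hi p}) (\<lambda>(p, \<sigma>). f p \<sigma>)"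
  obtains M where "M > 0" "\<And>p \<sigma>. p \<in> U \<Longrightarrow> \<sigma> \<in> {lo p..hi p} \<Longrightarrow> \<bar>f p \<sigma>\<bar> \<le> M"
proof -
  let ?g = "\<lambda>(p, r). f p (lo p + (hi p - lo p) * r)"
  have "compact (?g ` (U \<times> {0..1}))"
    by (intro compact_continuous_image continuous_on_unit_interval_pullback assms compact_Times) auto
  then obtain M where "M > 0" and M: "\<And>y. y \<in> ?g ` (U \<times> {0..1}) \<Longrightarrow> norm y \<le> M"
    by (meson bounded_pos compact_imp_bounded)
  show thesis
  proof (rule that[OF \<open>M > 0\<close>])
    fix p \<sigma> assume p: "p \<in> U" and \<sigma>: "\<sigma> \<in> {lo p..hi p}"
    \<comment> \<open>On a degenerate segment the quotient is 0, which is still an admissible parameter.\<close>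
    define r where "r = (\<sigma> - lo p) / (hi p - lo p)"
    have "r \<in> {0..1}" "\<sigma> = lo p + (hi p - lo p) * r"
      using \<sigma> by (auto simp: r_def divide_simps)
    then have "f p \<sigma> \<in> ?g ` (U \<times> {0..1})"
      using p by force
    then show "\<bar>f p \<sigma>\<bar> \<le> M" using M by fastforce
  qed
qed

text \<open>
  The source of the contraction: integrating an exponential up to \<open>h\<close> reproduces its value at
  \<open>h\<close> with a gain of \<open>1 / \<mu>\<close>, whatever the length of the interval.
\<close>

lemma abs_integral_le_exp:
  fixes g :: "real \<Rightarrow> real"
  assumes "l \<le> h" "0 < \<mu>" "0 \<le> C" "continuous_on {l..h} g"
    and g: "\<And>\<sigma>. \<sigma> \<in> {l..h} \<Longrightarrow> \<bar>g \<sigma>\<bar> \<le> C * exp (\<mu> * \<sigma>)"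
  shows "\<bar>integral {l..h} g\<bar> \<le> C / \<mu> * exp (\<mu> * h)"
proof -
  have I: "((\<lambda>\<sigma>. C * exp (\<mu> * \<sigma>)) has_integral
      C / \<mu> * exp (\<mu> * h) - C / \<mu> * exp (\<mu> * l)) {l..h}"
    using assms(1,2)
    by (intro fundamental_theorem_of_calculus)
      (auto intro!: derivative_eq_intros simp flip: has_real_derivative_iff_has_vector_derivative)
  have "norm (integral {l..h} g) \<le> integral {l..h} (\<lambda>\<sigma>. C * exp (\<mu> * \<sigma>))"
    by (rule integral_norm_bound_integral)
      (use I g assms(4) in \<open>auto intro: integrable_continuous_real\<close>)
  also have "\<dots> \<le> C / \<mu> * exp (\<mu> * h)"
    unfolding integral_unique[OF I] using assms(2,3) by simp
  finally show ?thesis by simp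
qed

section \<open>Volterra operators along a family of paths\<close>

text \<open>
  The path \<open>\<gamma> p\<close> is the segment of integration belonging to \<open>p\<close>.  The assumption \<open>level\<close> expresses
  the Volterra property quantitatively: the integral at \<open>p\<close> uses no points of higher level, and
  the level at parameter \<open>\<sigma>\<close> falls short of that of \<open>p\<close> by the length still to be travelled.
\<close>

locale volterra_family =
  fixes \<Omega> :: "'a::topological_space set"
    and lo hi :: "'a \<Rightarrow> real"
    and \<gamma> :: "'a \<Rightarrow> real \<Rightarrow> 'a"
    and k :: "'a \<Rightarrow> real \<Rightarrow> real"
    and \<phi> :: "'a \<Rightarrow> real"
  assumes compact: "compact \<Omega>"
    and lo: "continuous_on \<Omega> lo" and hi: "continuous_on \<Omega> hi"
    and le: "\<And>p. p \<in> \<Omega> \<Longrightarrow> lo p \<le> hi p"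
    and k: "continuous_on (SIGMA p:\<Omega>. {lo p..hi p}) (\<lambda>(p, \<sigma>). k p \<sigma>)"
    and \<gamma>: "continuous_on (SIGMA p:\<Omega>. {lo p..hi p}) (\<lambda>(p, \<sigma>). \<gamma> p \<sigma>)"
    and \<gamma>_in: "\<And>p \<sigma>. p \<in> \<Omega> \<Longrightarrow> \<sigma> \<in> {lo p..hi p} \<Longrightarrow> \<gamma> p \<sigma> \<in> \<Omega>"
    and level: "\<And>p \<sigma>. p \<in> \<Omega> \<Longrightarrow> \<sigma> \<in> {lo p..hi p} \<Longrightarrow> \<phi> (\<gamma> p \<sigma>) = \<phi> p - (hi p - \<sigma>)"
begin

definition volterra_op :: "('a \<Rightarrow> real) \<Rightarrow> 'a \<Rightarrow> real" where
  "volterra_op x p = integral {lo p..hi p} (\<lambda>\<sigma>. k p \<sigma> * x (\<gamma> p \<sigma>))"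

lemma continuous_on_integrand:
  assumes "continuous_on \<Omega> x"
  shows "continuous_on (SIGMA p:\<Omega>. {lo p..hi p}) (\<lambda>(p, \<sigma>). k p \<sigma> * x (\<gamma> p \<sigma>))"
proof -
  have "continuous_on (SIGMA p:\<Omega>. {lo p..hi p})
      (\<lambda>z. (\<lambda>(p, \<sigma>). k p \<sigma>) z * x ((\<lambda>(p, \<sigma>). \<gamma> p \<sigma>) z))"
    by (intro continuous_intros k continuous_on_compose2[OF assms \<gamma>]) (auto intro: \<gamma>_in)
  then show ?thesis by (simp add: case_prod_unfold)
qed

lemma continuous_on_volterra_op:
  assumes "continuous_on \<Omega> x"
  shows "continuous_on \<Omega> (volterra_op x)"
  unfolding volterra_op_def
  by (intro continuous_on_integral_variable_limits lo hi le continuous_on_integrand assms)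

text \<open>
  By \<open>level\<close>, the weight \<open>exp (\<mu> * \<phi>)\<close> is along each path a constant multiple of
  \<open>exp (\<mu> * \<sigma>)\<close>, so that the one-dimensional estimate applies with a factor \<open>M\<close> for the
  kernel.  It matters that \<open>M\<close> does not depend on \<open>\<mu>\<close>.
\<close>

lemma volterra_op_weighted_bound:
  obtains M where "M > 0"
    "\<And>\<mu> B x y p. \<lbrakk>\<mu> > 0; B \<ge> 0; continuous_on \<Omega> x; continuous_on \<Omega> y;
       \<And>q. q \<in> \<Omega> \<Longrightarrow> \<bar>x q - y q\<bar> \<le> B * exp (\<mu> * \<phi> q); p \<in> \<Omega>\<rbrakk>
     \<Longrightarrow> \<bar>volterra_op x p - volterra_op y p\<bar> \<le> M / \<mu> * B * exp (\<mu> * \<phi> p)"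
proof -
  obtain M where M: "M > 0" "\<And>p \<sigma>. p \<in> \<Omega> \<Longrightarrow> \<sigma> \<in> {lo p..hi p} \<Longrightarrow> \<bar>k p \<sigma>\<bar> \<le> M"
    using bounded_between_continuous_limits[OF compact lo hi le k] by blast
  show thesis
  proof (rule that[OF M(1)])
    fix \<mu> B :: real and x y p
    assume \<mu>: "\<mu> > 0" and B: "B \<ge> 0" and x: "continuous_on \<Omega> x" and y: "continuous_on \<Omega> y"
      and xy: "\<And>q. q \<in> \<Omega> \<Longrightarrow> \<bar>x q - y q\<bar> \<le> B * exp (\<mu> * \<phi> q)" and p: "p \<in> \<Omega>"
    note cont = continuous_on_section[OF continuous_on_integrand p]
    let ?g = "\<lambda>\<sigma>. k p \<sigma> * x (\<gamma> p \<sigma>) - k p \<sigma> * y (\<gamma> p \<sigma>)"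
    let ?C = "M * B * exp (\<mu> * (\<phi> p - hi p))"
    have "\<bar>?g \<sigma>\<bar> \<le> ?C * exp (\<mu> * \<sigma>)" if \<sigma>: "\<sigma> \<in> {lo p..hi p}" for \<sigma>
    proof -
      have "\<bar>?g \<sigma>\<bar> = \<bar>k p \<sigma>\<bar> * \<bar>x (\<gamma> p \<sigma>) - y (\<gamma> p \<sigma>)\<bar>"
        by (simp add: right_diff_distrib flip: abs_mult)
      also have "\<dots> \<le> M * (B * exp (\<mu> * \<phi> (\<gamma> p \<sigma>)))"
        using M p \<sigma> xy[OF \<gamma>_in[OF p \<sigma>]] by (intro mult_mono) auto
      also have "\<dots> = ?C * exp (\<mu> * \<sigma>)"
        by (simp add: level[OF p \<sigma>] algebra_simps flip: exp_add)
      finally show ?thesis .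
    qed
    then have "\<bar>integral {lo p..hi p} ?g\<bar> \<le> ?C / \<mu> * exp (\<mu> * hi p)"
      using le[OF p] \<mu> B M(1) by (intro abs_integral_le_exp continuous_intros cont x y) auto
    also have "\<dots> = M / \<mu> * B * exp (\<mu> * \<phi> p)"
      by (simp add: algebra_simps flip: exp_add)
    also have "integral {lo p..hi p} ?g = volterra_op x p - volterra_op y p"
      unfolding volterra_op_def
      by (intro integral_diff integrable_continuous_real cont x y)
    finally show "\<bar>volterra_op x p - volterra_op y p\<bar> \<le> M / \<mu> * B * exp (\<mu> * \<phi> p)" .
  qed
qed

end

section \<open>Fixed points of weighted contractions\<close>

text \<open>
  The contraction theorem for the weighted supremum norm on the continuous functions on \<open>\<Omega>\<close>.
  The complete space used is that of bounded continuous functions on the whole type: dividing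
  by \<open>w\<close> turns the weighted norm into the plain one, and composing with the nearest-point
  retraction onto the convex compact set \<open>\<Omega>\<close> extends a function from \<open>\<Omega>\<close> to the whole type.
\<close>

lemma weighted_contraction_fixed_point:
  fixes \<Omega> :: "'a::euclidean_space set" and A :: "('a \<Rightarrow> real) \<Rightarrow> 'a \<Rightarrow> real"
  assumes \<Omega>: "compact \<Omega>" "convex \<Omega>"
    and w: "continuous_on \<Omega> w" and w_pos: "\<And>p. p \<in> \<Omega> \<Longrightarrow> w p > 0"
    and q: "0 \<le> q" "q < 1"
    and A: "\<And>x. continuous_on \<Omega> x \<Longrightarrow> continuous_on \<Omega> (A x)"
    and contr: "\<And>x y B p. \<lbrakk>continuous_on \<Omega> x; continuous_on \<Omega> y; B \<ge> 0;
        \<And>p. p \<in> \<Omega> \<Longrightarrow> \<bar>x p - y p\<bar> \<le> B * w p; p \<in> \<Omega>\<rbrakk> \<Longrightarrow> \<bar>A x p - A y p\<bar> \<le> q * B * w p"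
  shows "\<exists>x. continuous_on \<Omega> x \<and> (\<forall>p\<in>\<Omega>. x p = A x p) \<and>
           (\<forall>y. continuous_on \<Omega> y \<and> (\<forall>p\<in>\<Omega>. y p = A y p) \<longrightarrow> (\<forall>p\<in>\<Omega>. y p = x p))"
proof (cases "\<Omega> = {}")
  case True
  then show ?thesis by auto
next
  case False
  define r where "r = closest_point \<Omega>"
  have r_in: "r p \<in> \<Omega>" for p
    unfolding r_def using \<Omega> False by (intro closest_point_in_set compact_imp_closed)
  have r_id: "r p = p" if "p \<in> \<Omega>" for p
    unfolding r_def using that by (rule closest_point_self)
  have r_cont: "continuous_on UNIV r"
    unfolding r_def using \<Omega> False by (intro continuous_on_closest_point compact_imp_closed)
  define scale where "scale x = Bcontfun (\<lambda>p. x (r p) / w (r p))" for x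
  have scale: "apply_bcontfun (scale x) p = x (r p) / w (r p)" if x: "continuous_on \<Omega> x" for x p
  proof -
    have "continuous_on \<Omega> (\<lambda>p. x p / w p)"
      using w_pos by (intro continuous_intros x w) force
    then have "continuous_on UNIV (\<lambda>p. x (r p) / w (r p))"
      "bounded ((\<lambda>p. x p / w p) ` \<Omega>)"
      using r_in \<Omega> by (auto intro: continuous_on_compose2[OF _ r_cont] compact_imp_bounded
          compact_continuous_image)
    moreover have "range (\<lambda>p. x (r p) / w (r p)) \<subseteq> (\<lambda>p. x p / w p) ` \<Omega>"
      using r_in by auto
    ultimately have "(\<lambda>p. x (r p) / w (r p)) \<in> bcontfun"
      by (auto simp: bcontfun_def intro: bounded_subset)
    then show ?thesis by (simp add: scale_def Bcontfun_inverse)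
  qed
  define unscale where "unscale g p = w p * apply_bcontfun g p" for g p
  have unscale: "continuous_on \<Omega> (unscale g)" for g
    unfolding unscale_def by (intro continuous_intros w) auto
  have unscale_scale: "unscale (scale x) p = x p" if "continuous_on \<Omega> x" "p \<in> \<Omega>" for x p
    using that w_pos[of p] by (simp add: unscale_def scale r_id)
  let ?\<Phi> = "\<lambda>g. scale (A (unscale g))"
  have "dist (?\<Phi> g) (?\<Phi> h) \<le> q * dist g h" for g h
  proof (rule dist_bound)
    fix p
    have *: "\<bar>unscale g s - unscale h s\<bar> \<le> dist g h * w s" if "s \<in> \<Omega>" for s
      using dist_bounded[of g s h] w_pos[OF that]
      by (simp add: unscale_def dist_real_def abs_mult mult.commute flip: right_diff_distrib)
    have "\<bar>A (unscale g) (r p) - A (unscale h) (r p)\<bar> \<le> q * dist g h * w (r p)"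
      by (rule contr) (auto intro: unscale r_in *)
    then show "dist (?\<Phi> g p) (?\<Phi> h p) \<le> q * dist g h"
      using w_pos[OF r_in, of p]
      by (simp add: scale A unscale dist_real_def abs_mult pos_divide_le_eq flip: diff_divide_distrib)
  qed
  then obtain g where g: "?\<Phi> g = g" and unique: "\<And>h. ?\<Phi> h = h \<Longrightarrow> h = g"
    using banach_fix_type[of q ?\<Phi>] q by metis
  show ?thesis
  proof (intro exI[of _ "unscale g"] conjI allI impI ballI)
    show "continuous_on \<Omega> (unscale g)" by (rule unscale)
    show "unscale g p = A (unscale g) p" if "p \<in> \<Omega>" for p
      using unscale_scale[OF A[OF unscale] that] g by metis
  next
    fix y p assume "continuous_on \<Omega> y \<and> (\<forall>p\<in>\<Omega>. y p = A y p)" and p: "p \<in> \<Omega>"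
    then have y: "continuous_on \<Omega> y" "\<And>p. p \<in> \<Omega> \<Longrightarrow> y p = A y p" by blast+
    \<comment> \<open>The contraction estimate with \<open>B = 0\<close> says that \<open>A\<close> only looks at values on \<open>\<Omega>\<close>.\<close>
    have local: "A (unscale (scale y)) s = A y s" if "s \<in> \<Omega>" for s
      using contr[of "unscale (scale y)" y 0 s] that by (simp add: unscale y(1) unscale_scale)
    have "?\<Phi> (scale y) = scale y"
      by (rule bcontfun_eqI) (simp add: scale A unscale y(1) local r_in flip: y(2))
    then have "scale y = g" by (rule unique)
    then show "y p = unscale g p" using unscale_scale[OF y(1) p] by simp
  qed
qed

section \<open>The Volterra equation on the truncated cylinder\<close>

lemma compact_cyl_domain: "compact (cyl_domain S T c)"
  and convex_cyl_domain: "convex (cyl_domain S T c)"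
proof -
  have eq: "cyl_domain S T c = ({0..S} \<times> {0..T}) \<inter> {z. (1, 1) \<bullet> z \<ge> c}"
    by (auto simp: cyl_domain_def)
  show "compact (cyl_domain S T c)"
    unfolding eq by (intro compact_Int_closed compact_Times closed_halfspace_ge) auto
  show "convex (cyl_domain S T c)"
    unfolding eq by (intro convex_Int convex_Times convex_halfspace_ge) auto
qed

theorem theorem5p8:
  fixes S T c :: real
    and a b :: "real \<Rightarrow> real"
    and F :: "real \<times> real \<Rightarrow> real"
    and K1 K2 :: "real \<Rightarrow> real \<Rightarrow> real \<Rightarrow> real"
  defines "\<Omega> \<equiv> cyl_domain S T c"
  assumes "0 \<le> S" and "0 \<le> T" and "0 < c"
    and "continuous_on {0..T} a" and "a \<in> {0..T} \<rightarrow> {0..S}"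
    and "continuous_on {0..S} b" and "b \<in> {0..S} \<rightarrow> {0..T}"
    and "limits_compatible \<Omega> a b"
    and "continuous_on \<Omega> F"
    and "continuous_on (kernel_domain \<Omega> a b) (\<lambda>(s, t, \<sigma>, \<tau>). K1 s t \<sigma>)"
    and "continuous_on (kernel_domain \<Omega> a b) (\<lambda>(s, t, \<sigma>, \<tau>). K2 s t \<tau>)"
  shows "\<exists>x. continuous_on \<Omega> x \<and> volterra_solution \<Omega> a b F K1 K2 x \<and>
           (\<forall>y. continuous_on \<Omega> y \<and> volterra_solution \<Omega> a b F K1 K2 y \<longrightarrow>
              (\<forall>p \<in> \<Omega>. y p = x p))"
proof -
  have \<Omega>: "fst p \<in> {0..S}" "snd p \<in> {0..T}" if "p \<in> \<Omega>" for p
    using that by (auto simp: \<Omega>_def cyl_domain_def)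
  have compact_\<Omega>: "compact \<Omega>"
    unfolding \<Omega>_def by (rule compact_cyl_domain)
  have limits: "a (snd p) \<le> fst p" "b (fst p) \<le> snd p"
    "\<And>\<sigma>. \<sigma> \<in> {a (snd p)..fst p} \<Longrightarrow> (\<sigma>, snd p) \<in> \<Omega>"
    "\<And>\<tau>. \<tau> \<in> {b (fst p)..snd p} \<Longrightarrow> (fst p, \<tau>) \<in> \<Omega>" if "p \<in> \<Omega>" for p
    using \<open>limits_compatible \<Omega> a b\<close> that by (auto simp: limits_compatible_def)
  have a: "continuous_on \<Omega> (\<lambda>p. a (snd p))"
    using \<Omega> by (intro continuous_on_compose2[OF \<open>continuous_on {0..T} a\<close>] continuous_intros) auto
  have b: "continuous_on \<Omega> (\<lambda>p. b (fst p))"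
    using \<Omega> by (intro continuous_on_compose2[OF \<open>continuous_on {0..S} b\<close>] continuous_intros) auto
  let ?k1 = "\<lambda>p. K1 (fst p) (snd p)" and ?k2 = "\<lambda>p. K2 (fst p) (snd p)"
  let ?\<phi> = "\<lambda>p :: real \<times> real. fst p + snd p"
  \<comment> \<open>Each kernel ignores one of the two integration variables; fixing that variable at its
    upper limit stays inside the kernel domain.\<close>
  have "continuous_on (SIGMA p:\<Omega>. {a (snd p)..fst p})
      (\<lambda>z. (\<lambda>(s, t, \<sigma>, \<tau>). K1 s t \<sigma>) (fst (fst z), snd (fst z), snd z, snd (fst z)))"
    by (rule continuous_on_compose2[OF assms(11)])
      (auto intro!: continuous_intros limits dest: limits simp: kernel_domain_def)
  then have k1: "continuous_on (SIGMA p:\<Omega>. {a (snd p)..fst p}) (\<lambda>(p, \<sigma>). ?k1 p \<sigma>)"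
    by (simp add: case_prod_unfold)
  have "continuous_on (SIGMA p:\<Omega>. {b (fst p)..snd p})
      (\<lambda>z. (\<lambda>(s, t, \<sigma>, \<tau>). K2 s t \<tau>) (fst (fst z), snd (fst z), fst (fst z), snd z))"
    by (rule continuous_on_compose2[OF assms(12)])
      (auto intro!: continuous_intros limits dest: limits simp: kernel_domain_def)
  then have k2: "continuous_on (SIGMA p:\<Omega>. {b (fst p)..snd p}) (\<lambda>(p, \<tau>). ?k2 p \<tau>)"
    by (simp add: case_prod_unfold)
  interpret V1: volterra_family \<Omega> "\<lambda>p. a (snd p)" fst "\<lambda>p \<sigma>. (\<sigma>, snd p)" ?k1 ?\<phi>
  proof
    show "continuous_on (SIGMA p:\<Omega>. {a (snd p)..fst p}) (\<lambda>(p, \<sigma>). (\<sigma>, snd p))"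
      unfolding case_prod_unfold by (intro continuous_intros)
    show "continuous_on \<Omega> fst"
      using continuous_on_fst[OF continuous_on_id] by simp
  qed (use limits in \<open>simp_all add: compact_\<Omega> a k1\<close>)
  interpret V2: volterra_family \<Omega> "\<lambda>p. b (fst p)" snd "\<lambda>p \<tau>. (fst p, \<tau>)" ?k2 ?\<phi>
  proof
    show "continuous_on (SIGMA p:\<Omega>. {b (fst p)..snd p}) (\<lambda>(p, \<tau>). (fst p, \<tau>))"
      unfolding case_prod_unfold by (intro continuous_intros)
    show "continuous_on \<Omega> snd"
      using continuous_on_snd[OF continuous_on_id] by simp
  qed (use limits in \<open>simp_all add: compact_\<Omega> b k2\<close>)
  define A where "A x p = F p + V1.volterra_op x p + V2.volterra_op x p" for x p
  have solution_iff: "volterra_solution \<Omega> a b F K1 K2 x \<longleftrightarrow> (\<forall>p\<in>\<Omega>. x p = A x p)" for x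
    by (auto simp: volterra_solution_def A_def V1.volterra_op_def V2.volterra_op_def)
  have A_cont: "continuous_on \<Omega> (A x)" if "continuous_on \<Omega> x" for x
    unfolding A_def using that
    by (intro continuous_intros \<open>continuous_on \<Omega> F\<close> V1.continuous_on_volterra_op
        V2.continuous_on_volterra_op)
  obtain M1 where M1: "M1 > 0"
    "\<And>\<mu> B x y p. \<lbrakk>\<mu> > 0; B \<ge> 0; continuous_on \<Omega> x; continuous_on \<Omega> y;
       \<And>q. q \<in> \<Omega> \<Longrightarrow> \<bar>x q - y q\<bar> \<le> B * exp (\<mu> * ?\<phi> q); p \<in> \<Omega>\<rbrakk>
     \<Longrightarrow> \<bar>V1.volterra_op x p - V1.volterra_op y p\<bar> \<le> M1 / \<mu> * B * exp (\<mu> * ?\<phi> p)"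
    by (rule V1.volterra_op_weighted_bound) blast
  obtain M2 where M2: "M2 > 0"
    "\<And>\<mu> B x y p. \<lbrakk>\<mu> > 0; B \<ge> 0; continuous_on \<Omega> x; continuous_on \<Omega> y;
       \<And>q. q \<in> \<Omega> \<Longrightarrow> \<bar>x q - y q\<bar> \<le> B * exp (\<mu> * ?\<phi> q); p \<in> \<Omega>\<rbrakk>
     \<Longrightarrow> \<bar>V2.volterra_op x p - V2.volterra_op y p\<bar> \<le> M2 / \<mu> * B * exp (\<mu> * ?\<phi> p)"
    by (rule V2.volterra_op_weighted_bound) blast
  \<comment> \<open>This rate makes the contraction constant \<open>M1 / \<mu> + M2 / \<mu>\<close> equal to one half.\<close>
  define \<mu> where "\<mu> = 2 * (M1 + M2)"
  have \<mu>: "\<mu> > 0" using M1(1) M2(1) by (simp add: \<mu>_def)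
  have half: "M1 / \<mu> + M2 / \<mu> = 1 / 2"
    using M1(1) M2(1) by (simp add: \<mu>_def divide_simps)
  have contr: "\<bar>A x p - A y p\<bar> \<le> 1 / 2 * B * exp (\<mu> * ?\<phi> p)"
    if "continuous_on \<Omega> x" "continuous_on \<Omega> y" "B \<ge> 0"
      "\<And>q. q \<in> \<Omega> \<Longrightarrow> \<bar>x q - y q\<bar> \<le> B * exp (\<mu> * ?\<phi> q)" "p \<in> \<Omega>" for x y B p
  proof -
    have "\<bar>A x p - A y p\<bar> \<le> \<bar>V1.volterra_op x p - V1.volterra_op y p\<bar>
        + \<bar>V2.volterra_op x p - V2.volterra_op y p\<bar>"
      by (simp add: A_def)
    also have "\<dots> \<le> M1 / \<mu> * B * exp (\<mu> * ?\<phi> p) + M2 / \<mu> * B * exp (\<mu> * ?\<phi> p)"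
      using that \<mu> by (intro add_mono M1 M2) auto
    also have "\<dots> = (M1 / \<mu> + M2 / \<mu>) * B * exp (\<mu> * ?\<phi> p)"
      by (simp add: distrib_right)
    finally show ?thesis by (simp only: half)
  qed
  have "convex \<Omega>"
    unfolding \<Omega>_def by (rule convex_cyl_domain)
  moreover have "continuous_on \<Omega> (\<lambda>p. exp (\<mu> * ?\<phi> p))"
    by (intro continuous_intros)
  ultimately show ?thesis
    unfolding solution_iff
    by (intro weighted_contraction_fixed_point[OF compact_\<Omega> _ _ _ _ _ A_cont contr]) simp_all
qed

end
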